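(* Let $k \geq 1$, $t \geq 2$, and $m \geq 3$ be integers. Then $r_k(K_{2,t};K_m) > (m-1)(t+1)$.
   Context: For graphs $H, G$ and an integer $k\ge 1$, the Ramsey number $r_k(H;G)$ is the minimum integer $r$ such that in every edge-coloring of the complete graph $K_r$ with $k+1$ colors, there is a monochromatic copy of $H$ in one of the first $k$ colors or a copy of $G$ in the $(k+1)$-st color (copies are not necessarily induced subgraphs). $K_{2,t}$ is the complete bipartite graph with parts of sizes $2$ and $t$; $K_m$ is the complete graph on $m$ vertices. *)

theory Defs
  imports "HOL-Library.Ramsey"
begin

text \<open>A simple graph is a pair of a vertex set and a set of two-element sets of vertices.\<close>

type_synonym 'a graph = "'a set \<times> 'a set set"

abbreviation verts :: "'a graph \<Rightarrow> 'a set" where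
  "verts \<equiv> fst"

abbreviation edges :: "'a graph \<Rightarrow> 'a set set" where
  "edges \<equiv> snd"

definition complete_graph :: "nat \<Rightarrow> nat graph" where
  "complete_graph n = ({..<n}, [{..<n}]\<^bsup>2\<^esup>)"

definition complete_bipartite_graph :: "nat \<Rightarrow> nat \<Rightarrow> (nat + nat) graph" where
  "complete_bipartite_graph s t =
     ({..<s} <+> {..<t}, {{Inl i, Inr j} | i j. i < s \<and> j < t})"

text \<open>Copies need not be induced: edges are preserved, non-edges need not be.\<close>

definition contains_copy :: "'a graph \<Rightarrow> 'b graph \<Rightarrow> bool" where
  "contains_copy G H \<longleftrightarrow>
     (\<exists>f. inj_on f (verts H) \<and> f ` verts H \<subseteq> verts G \<and> (\<forall>e\<in>edges H. f ` e \<in> edges G))"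

definition color_class :: "'a graph \<Rightarrow> ('a set \<Rightarrow> nat) \<Rightarrow> nat \<Rightarrow> 'a graph" where
  "color_class G c i = (verts G, {e \<in> edges G. c e = i})"

text \<open>The \<open>k + 1\<close> colors are \<open>0, \<dots>, k\<close>. The first \<open>k\<close> of them are those \<open>i < k\<close>, and
  color \<open>k\<close> is the last one.\<close>

definition ramsey_property :: "nat \<Rightarrow> 'a graph \<Rightarrow> 'b graph \<Rightarrow> nat \<Rightarrow> bool" where
  "ramsey_property k H G r \<longleftrightarrow>
     (\<forall>c \<in> edges (complete_graph r) \<rightarrow> {..k}.
        (\<exists>i<k. contains_copy (color_class (complete_graph r) c i) H) \<or>
        contains_copy (color_class (complete_graph r) c k) G)"

definition ramsey_number :: "nat \<Rightarrow> 'a graph \<Rightarrow> 'b graph \<Rightarrow> nat" where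
  "ramsey_number k H G = (LEAST r. ramsey_property k H G r)"

text \<open>The minimum exists for all finite simple graphs, so \<open>LEAST\<close> is never taken over an
  empty set below.\<close>

lemma contains_copy_of_clique:
  fixes H :: "'a graph" and G :: "'b graph"
  assumes fin: "finite (verts H)" and sub: "edges H \<subseteq> [verts H]\<^bsup>2\<^esup>"
    and X: "X \<in> [verts G]\<^bsup>card (verts H)\<^esup>" "[X]\<^bsup>2\<^esup> \<subseteq> edges G"
  shows "contains_copy G H"
proof -
  have "finite X" "card X = card (verts H)" "X \<subseteq> verts G"
    using X(1) by (auto simp: nsets_def)
  then obtain f where f: "bij_betw f (verts H) X"
    using fin finite_same_card_bij by metis
  then have "f ` e \<in> edges G" if "e \<in> edges H" for e
  proof -
    have e: "e \<subseteq> verts H" "finite e" "card e = 2"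
      using that sub by (auto simp: nsets_def)
    have "inj_on f e"
      using f e(1) by (meson bij_betw_imp_inj_on inj_on_subset)
    then have "f ` e \<in> [X]\<^bsup>2\<^esup>"
      using f e by (auto simp: nsets_def card_image bij_betw_def)
    then show ?thesis using X(2) by blast
  qed
  then show ?thesis
    unfolding contains_copy_def using f \<open>X \<subseteq> verts G\<close> by (auto simp: bij_betw_def)
qed

lemma ex_ramsey_property:
  fixes H :: "'a graph" and G :: "'b graph"
  assumes "finite (verts H)" "edges H \<subseteq> [verts H]\<^bsup>2\<^esup>"
    and "finite (verts G)" "edges G \<subseteq> [verts G]\<^bsup>2\<^esup>"
  shows "\<exists>r. ramsey_property k H G r"
proof -
  define qs where "qs = replicate k (card (verts H)) @ [card (verts G)]"
  obtain N :: nat where N: "partn_lst {..<N} qs 2"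
    using ramsey_full by blast
  have len: "length qs = Suc k" by (simp add: qs_def)
  have "ramsey_property k H G N"
    unfolding ramsey_property_def
  proof
    fix c assume "c \<in> edges (complete_graph N) \<rightarrow> {..k}"
    then have "c \<in> [{..<N}]\<^bsup>2\<^esup> \<rightarrow> {..<length qs}"
      by (auto simp: complete_graph_def len Pi_iff less_Suc_eq_le)
    then obtain i X where i: "i < length qs" and X: "X \<in> [{..<N}]\<^bsup>(qs ! i)\<^esup>"
      and mono: "c ` [X]\<^bsup>2\<^esup> \<subseteq> {i}"
      using N by (fastforce simp: partn_lst_def monochromatic_def)
    let ?C = "color_class (complete_graph N) c i"
    have V: "verts ?C = {..<N}" by (simp add: color_class_def complete_graph_def)
    have "X \<subseteq> {..<N}" using X by (auto simp: nsets_def)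
    then have E: "[X]\<^bsup>2\<^esup> \<subseteq> edges ?C"
      using mono nsets_mono[of X "{..<N}" 2]
      by (auto simp: color_class_def complete_graph_def)
    show "(\<exists>i<k. contains_copy (color_class (complete_graph N) c i) H) \<or>
        contains_copy (color_class (complete_graph N) c k) G"
    proof (cases "i < k")
      case True
      then have "X \<in> [verts ?C]\<^bsup>card (verts H)\<^esup>"
        using X V by (simp add: qs_def nth_append)
      then show ?thesis using contains_copy_of_clique[OF assms(1,2)] E True by blast
    next
      case False
      then have "i = k" using i len by simp
      then have "X \<in> [verts ?C]\<^bsup>card (verts G)\<^esup>"
        using X V by (simp add: qs_def nth_append)
      then show ?thesis using contains_copy_of_clique[OF assms(3,4)] E \<open>i = k\<close> by blast
    qed
  qed
  then show ?thesis ..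
qed

end

theory Submission
  imports Defs
begin

text \<open>Split \<open>(m - 1) (t + 1)\<close> vertices into \<open>m - 1\<close> blocks of size \<open>t + 1\<close>. Color the edges
  inside the blocks with the first color and all other edges with the last one. The first color
  has components with fewer than \<open>t + 2\<close> vertices, whereas \<open>K\<^sub>2\<^sub>,\<^sub>t\<close> is connected; a clique in the
  last color has at most one vertex in each block.\<close>

definition block_coloring :: "nat \<Rightarrow> nat \<Rightarrow> nat set \<Rightarrow> nat" where
  "block_coloring k s e = (if \<exists>q. \<forall>v\<in>e. v div s = q then 0 else k)"

lemma block_coloring_pair:
  "block_coloring k s {u, v} = (if u div s = v div s then 0 else k)"
  by (auto simp: block_coloring_def)

lemma block_coloring_no_complete_bipartite:
  assumes "t \<ge> 1" and "i < k"
  shows "\<not> contains_copy (color_class G (block_coloring k (t + 1)) i)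
            (complete_bipartite_graph 2 t)"
proof
  assume "contains_copy (color_class G (block_coloring k (t + 1)) i)
            (complete_bipartite_graph 2 t)"
  then obtain f where inj: "inj_on f ({..<2} <+> {..<t})"
    and edge: "\<And>e. e \<in> edges (complete_bipartite_graph 2 t)
                 \<Longrightarrow> block_coloring k (t + 1) (f ` e) = i"
    by (auto simp: contains_copy_def color_class_def complete_bipartite_graph_def)
  have col: "block_coloring k (t + 1) {f (Inl a), f (Inr b)} = i" if "a < 2" "b < t" for a b
    using edge[of "{Inl a, Inr b}"] that by (auto simp: complete_bipartite_graph_def)
  \<comment> \<open>A color below \<open>k\<close> can only come from the first branch of
    \<open>block_coloring\<close>, so the ends share a block whichever \<open>i < k\<close> is
    given.\<close>
  have same: "f (Inl a) div (t + 1) = f (Inr b) div (t + 1)" if "a < 2" "b < t" for a b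
    using col[OF that] \<open>i < k\<close> by (auto simp: block_coloring_pair split: if_splits)
  define q where "q = f (Inl 0) div (t + 1)"
  have right: "f (Inr b) div (t + 1) = q" if "b < t" for b
    using same[of 0 b] that by (simp add: q_def)
  \<comment> \<open>Connectivity: both left vertices are adjacent to \<open>Inr 0\<close>, which
    exists because \<open>t \<ge> 1\<close>.\<close>
  have left: "f (Inl a) div (t + 1) = q" if "a < 2" for a
    using same[of a 0] right[of 0] that \<open>t \<ge> 1\<close> by simp
  have "f x \<in> {q * (t + 1)..<q * (t + 1) + (t + 1)}" if "x \<in> {..<2} <+> {..<t}" for x
  proof -
    have "f x div (t + 1) = q" using that left right by auto
    then show ?thesis
      using div_times_less_eq_dividend[of "f x" "t + 1"]
        dividend_less_div_times[of "t + 1" "f x"] by (simp del: add_Suc_right)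
  qed
  \<comment> \<open>Pigeonhole: \<open>t + 2\<close> vertices would inject into one block of
    \<open>t + 1\<close> integers.\<close>
  then have "card ({..<2::nat} <+> {..<t}) \<le> card {q * (t + 1)..<q * (t + 1) + (t + 1)}"
    by (intro card_inj_on_le[OF inj] image_subsetI) auto
  then show False by (simp add: card_Plus)
qed

text \<open>Two clique vertices in one block would span an edge of color \<open>0\<close>, which
  differs from \<open>k\<close> as \<open>k \<ge> 1\<close>. So the block index is injective on the
  clique, but it takes only \<open>n < m\<close> values.\<close>

lemma block_coloring_no_complete:
  assumes "k \<ge> 1" and "n < m" and "verts G \<subseteq> {..<n * s}"
  shows "\<not> contains_copy (color_class G (block_coloring k s) k) (complete_graph m)"
proof
  assume "contains_copy (color_class G (block_coloring k s) k) (complete_graph m)"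
  then obtain f where "f ` {..<m} \<subseteq> verts G"
    and col: "\<And>e. e \<in> [{..<m}]\<^bsup>2\<^esup> \<Longrightarrow> block_coloring k s (f ` e) = k"
    by (auto simp: contains_copy_def color_class_def complete_graph_def)
  then have ran: "f ` {..<m} \<subseteq> {..<n * s}" using assms(3) by blast
  have "inj_on (\<lambda>v. f v div s) {..<m}"
  proof (rule inj_onI, rule ccontr)
    fix u v assume uv: "u \<in> {..<m}" "v \<in> {..<m}" "f u div s = f v div s" "u \<noteq> v"
    then have "{u, v} \<in> [{..<m}]\<^bsup>2\<^esup>" by (auto simp: nsets_def)
    from col[OF this] show False using uv \<open>k \<ge> 1\<close> by (simp add: block_coloring_pair)
  qed
  moreover have "(\<lambda>v. f v div s) ` {..<m} \<subseteq> {..<n}"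
    using ran by (auto simp: image_subset_iff less_mult_imp_div_less)
  ultimately have "card {..<m} \<le> card {..<n}" by (intro card_inj_on_le) auto
  with \<open>n < m\<close> show False by simp
qed

text \<open>The same coloring serves the first \<open>r\<close> vertices for every \<open>r\<close>
  up to the bound. Refuting all these \<open>r\<close> at once bounds the least good
  \<open>r\<close> without an appeal to monotonicity of \<open>ramsey_property\<close>.\<close>

lemma block_coloring_not_ramsey_property:
  assumes "k \<ge> 1" and "t \<ge> 1" and "n < m" and "r \<le> n * (t + 1)"
  shows "\<not> ramsey_property k (complete_bipartite_graph 2 t) (complete_graph m) r"
proof -
  have "verts (complete_graph r) \<subseteq> {..<n * (t + 1)}"
    using assms(4) by (auto simp: complete_graph_def)
  moreover have "block_coloring k (t + 1) \<in> edges (complete_graph r) \<rightarrow> {..k}"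
    by (auto simp: block_coloring_def)
  ultimately show ?thesis
    unfolding ramsey_property_def
    using block_coloring_no_complete_bipartite block_coloring_no_complete assms(1-3) by blast
qed

theorem proposition2:
  fixes k t m :: nat
  assumes "k \<ge> 1" and "t \<ge> 2" and "m \<ge> 3"
  shows "ramsey_number k (complete_bipartite_graph 2 t) (complete_graph m) > (m - 1) * (t + 1)"
proof -
  let ?P = "ramsey_property k (complete_bipartite_graph 2 t) (complete_graph m)"
  \<comment> \<open>Existence ensures that the \<open>LEAST\<close> value itself satisfies
    \<open>?P\<close>, so it cannot be one of the refuted \<open>r\<close>.\<close>
  have "\<exists>r. ?P r"
    by (rule ex_ramsey_property)
      (auto simp: complete_bipartite_graph_def complete_graph_def nsets_def)
  then have "?P (ramsey_number k (complete_bipartite_graph 2 t) (complete_graph m))"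
    unfolding ramsey_number_def by (rule LeastI_ex)
  moreover have "\<not> ?P r" if "r \<le> (m - 1) * (t + 1)" for r
    using block_coloring_not_ramsey_property[OF _ _ _ that] assms by simp
  ultimately show ?thesis
    using not_le_imp_less by blast
qed

end
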